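(* Let $M$ be a region with the data of the context: a linear theory with quadratic action $S_M$ and an affine theory with action $S_M^\mu=S_M+C_M^\mu$, where $C_M^\mu$ is linear, and suppose that there is $\eta_0\in A_M$ that vanishes on the boundary of $M$. Let $\rho_M$ and $\rho_M^\mu$ be the amplitude maps of the linear and the affine theory. Then for every $\xi\in L_{\partial M}$, with decomposition $\xi=\xi^{\mathrm{R}}+J_{\partial M}\xi^{\mathrm{I}}$, $\xi^{\mathrm{R}},\xi^{\mathrm{I}}\in L_M$, $$\rho_M^\mu(K_\xi)=\rho_M(K_\xi)\,\exp\left(\mathrm{i}\,C_M^\mu(\xi^{\mathrm{R}}-\mathrm{i}\,\xi^{\mathrm{I}})\right)\rho_M^\mu(K_0),$$ where $C_M^\mu$ is extended complex linearly. Moreover, for $\eta\in A_M$, with decomposition $\eta=\eta^{\mathrm{R}}+J_{\partial M}\eta^{\mathrm{I}}$, $\eta^{\mathrm{R}},\eta^{\mathrm{I}}\in L_M$ (here $\eta^{\mathrm{I}}$ does not depend on the choice of $\eta$), $$\rho_M^\mu(K_0)=\exp\left(\frac{\mathrm{i}}2C_M^\mu(J_{\partial M}\eta^{\mathrm{I}})-\frac12C_M^\mu(\eta^{\mathrm{I}})\right),$$ where $J_{\partial M}\eta^{\mathrm{I}}$ in the argument of $C_M^\mu$ denotes the element $\eta-\eta^{\mathrm{R}}\in A_M$.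
   Context: Setting (Lagrangian field theory on a region $M$). $K_M$ is a real vector space (field configurations in $M$), with subspace $K_M^0\subseteq K_M$ of configurations vanishing on the boundary of $M$. $S_M:K_M\to\mathbb{R}$ is a quadratic form (first order Lagrangian action) and $C_M^\mu:K_M\to\mathbb{R}$ is linear, with $C_M^\mu$ depending only on the configuration away from the boundary; $S_M^\mu:=S_M+C_M^\mu$. $L_M\subseteq K_M$ is the vector space of solutions of the Euler--Lagrange equations of $S_M$, i.e. of those $\xi$ at which the derivative of $S_M$ vanishes in all directions in $K_M^0$; $A_M\subseteq K_M$ is the space of solutions of the Euler--Lagrange equations of $S_M^\mu$, i.e. of those $\eta$ at which the derivative of $S_M^\mu$ vanishes in all directions in $K_M^0$; $A_M$ is an affine space over $L_M$. Boundary data. Near $\partial M$ both theories coincide and are linear; the solution space near $\partial M$ is (a completion of) a vector space, $A_{\partial M}=L_{\partial M}$. $L_{\partial M}$ is a complex separable Hilbert space with inner product $\{\cdot,\cdot\}_{\partial M}$ (conjugate linear in the first, linear in the second argument); $g_{\partial M}:=\Re\{\cdot,\cdot\}_{\partial M}$, $\omega_{\partial M}:=\frac12\Im\{\cdot,\cdot\}_{\partial M}$, $J_{\partial M}$ is multiplication by $\mathrm{i}$. There is a continuous real bilinear form $[\cdot,\cdot]_{\partial M}$ on $L_{\partial M}$ (the symplectic potential $\theta_{\partial M}(\varphi,\xi)=[\varphi,\xi]_{\partial M}$, $\theta_{\partial M}(\varphi,X)=-\int_{\partial M}X^a\,\partial_\mu\lrcorner\frac{\delta\Lambda}{\delta\,\partial_\mu\varphi^a}|_\varphi$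 with $\Lambda$ the Lagrangian density), with $\omega_{\partial M}(\phi,\phi')=\frac12[\phi,\phi']_{\partial M}-\frac12[\phi',\phi]_{\partial M}$. Restriction to the boundary is assumed injective on $L_M$ and on $A_M$, so that both are identified with their images in $L_{\partial M}$; $L_M$ is a closed Lagrangian subspace of the real Hilbert space $L_{\partial M}$ with respect to $\omega_{\partial M}$. Hence $L_{\partial M}=L_M\oplus J_{\partial M}L_M$ (orthogonal direct sum of real Hilbert spaces), written $\phi=\phi^{\mathrm{R}}+J_{\partial M}\phi^{\mathrm{I}}$. The actions satisfy $S_M^\mu(\eta+\xi)=S_M^\mu(\eta)-\frac12[\xi,\xi]_{\partial M}-[\eta,\xi]_{\partial M}$ for $\eta\in A_M$, $\xi\in L_M$, and $S_M(\xi)=-\frac12[\xi,\xi]_{\partial M}$ for $\xi\in L_M$. That $\eta_0\in A_M$ vanishes on the boundary means $\eta_0\in K_M^0$, and (since the symplectic potential depends on its second argument only through its boundary values) $[\phi,\eta_0]_{\partial M}=0$ for all $\phi\in L_{\partial M}$. Amplitudes. For a real Hilbert space $L$, $\hat L$ is the algebraic dual of the topological dual of $L$ ($L\subseteq\hat L$; continuous linear functionals, hence their exponentials, extend to $\hat L$ by evaluation). $\nu$ is the centred Gaussian probability measure on $\hat L_M$ with $\int e^{\mathrm{i}g_{\partial M}(\xi,\phi)}\,\mathrm{d}\nu(\phi)=e^{-g_{\partial M}(\xi,\xi)}$ for $\xi\in L_M$. For $\eta\in L_{\partial M}$ let $\alpha^\eta(\varphi):=\exp(\frac{\mathrm{i}}2[\eta,\varphi-\eta]_{\partial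 M}+\frac{\mathrm{i}}2[\varphi,\varphi-\eta]_{\partial M}-\frac14g_{\partial M}(\varphi-\eta,\varphi-\eta))$. A state is a function $\psi$ on $A_{\partial M}=L_{\partial M}$; write $\psi(\varphi)=\chi^\eta(\varphi-\eta)\alpha^\eta(\varphi)$. The coherent state $K_\xi$, $\xi\in L_{\partial M}$, is the state with $\chi^0(\phi)=\exp(\frac12\{\xi,\phi\}_{\partial M})$, i.e. the function $\varphi\mapsto\exp(\frac12\{\xi,\varphi\}_{\partial M})\alpha^0(\varphi)$. The amplitude of the affine theory is $\rho_M^\mu(\psi):=\exp(\mathrm{i}S_M^\mu(\eta))\int_{\hat L_M}\chi^\eta(\phi)\,\mathrm{d}\nu(\phi)$ for any $\eta\in A_M$ (the result does not depend on $\eta$), and that of the linear theory is $\rho_M(\psi):=\int_{\hat L_M}\chi^0(\phi)\,\mathrm{d}\nu(\phi)$. *)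

theory Defs
  imports "HOL-Probability.Probability"
begin

text \<open>
  The library has no complex inner product spaces. The real Hilbert space underlying an instance of
  the class below is the library's, with the real part of the complex inner product as real inner
  product. For metric spaces, separability is second countability, which is part of
  \<^class>\<open>polish_space\<close>.
\<close>

class complex_hilbert_space = real_inner + polish_space +
  fixes scaleC :: "complex \<Rightarrow> 'a \<Rightarrow> 'a"  (infixr "*\<^sub>C" 75)
    and cinner :: "'a \<Rightarrow> 'a \<Rightarrow> complex"
  assumes scaleC_add_right: "c *\<^sub>C (x + y) = c *\<^sub>C x + c *\<^sub>C y"
    and scaleC_add_left: "(c + d) *\<^sub>C x = c *\<^sub>C x + d *\<^sub>C x"
    and scaleC_scaleC: "c *\<^sub>C (d *\<^sub>C x) = (c * d) *\<^sub>C x"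
    and scaleR_scaleC: "r *\<^sub>R x = complex_of_real r *\<^sub>C x"
    and cinner_commute: "cinner x y = cnj (cinner y x)"
    and cinner_add_right: "cinner x (y + z) = cinner x y + cinner x z"
    and cinner_scaleC_right: "cinner x (c *\<^sub>C y) = c * cinner x y"
    and inner_eq_Re_cinner: "inner x y = Re (cinner x y)"

definition g_bd :: "'l::complex_hilbert_space \<Rightarrow> 'l \<Rightarrow> real" where
  "g_bd x y = Re (cinner x y)"

definition omega_bd :: "'l::complex_hilbert_space \<Rightarrow> 'l \<Rightarrow> real" where
  "omega_bd x y = Im (cinner x y) / 2"

definition J_bd :: "'l::complex_hilbert_space \<Rightarrow> 'l" where
  "J_bd x = \<i> *\<^sub>C x"

definition lagrangian_subspace :: "'l::complex_hilbert_space set \<Rightarrow> bool" where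
  "lagrangian_subspace V \<longleftrightarrow> subspace V \<and> V = {x. \<forall>y\<in>V. omega_bd x y = 0}"

definition quadratic_form :: "('k::real_vector \<Rightarrow> real) \<Rightarrow> bool" where
  "quadratic_form S \<longleftrightarrow> (\<exists>B. bilinear B \<and> (\<forall>x. S x = B x x))"

definition EL_solutions :: "'k::real_vector set \<Rightarrow> ('k \<Rightarrow> real) \<Rightarrow> 'k set" where
  "EL_solutions K0 S =
     {\<xi>. \<forall>\<kappa>\<in>K0. ((\<lambda>t. S (\<xi> + t *\<^sub>R \<kappa>)) has_real_derivative 0) (at 0)}"

definition affine_action :: "('k \<Rightarrow> real) \<Rightarrow> ('k \<Rightarrow> real) \<Rightarrow> 'k \<Rightarrow> real" where
  "affine_action S C \<eta> = S \<eta> + C \<eta>"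

text \<open>The complex linear extension of \<open>C\<close>, evaluated at \<open>x + \<i> y\<close>.\<close>

definition complex_ext :: "('k \<Rightarrow> real) \<Rightarrow> 'k \<Rightarrow> 'k \<Rightarrow> complex" where
  "complex_ext C x y = of_real (C x) + \<i> * of_real (C y)"

text \<open>
  The type \<open>'k\<close> is the space of field configurations in the region, \<open>'l\<close> the Hilbert space of
  boundary solutions. \<open>K0\<close> are the configurations vanishing on the boundary and \<open>Kn\<close> the
  configurations vanishing away from (i.e. supported near) the boundary, on which \<open>C\<close> must vanish.
  The map \<open>r\<close> restricts solutions to the boundary; only its values on the two solution spaces
  matter, and asking it to be linear on all of \<open>'k\<close> is no restriction because every linear map
  on a subspace extends. The form \<open>\<theta>\<close> is the symplectic potential \<open>[\<cdot>,\<cdot>]\<close>.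
\<close>

locale affine_field_theory =
  fixes K0 Kn :: "'k::real_vector set"
    and S C :: "'k \<Rightarrow> real"
    and r :: "'k \<Rightarrow> 'l::complex_hilbert_space"
    and \<theta> :: "'l \<Rightarrow> 'l \<Rightarrow> real"
  assumes K0_subspace: "subspace K0"
    and Kn_subspace: "subspace Kn"
    and S_quadratic: "quadratic_form S"
    and C_linear: "linear C"
    and C_local: "\<And>\<kappa>. \<kappa> \<in> Kn \<Longrightarrow> C \<kappa> = 0"
    and r_linear: "linear r"
    and r_inj_lin: "inj_on r (EL_solutions K0 S)"
    and r_inj_aff: "inj_on r (EL_solutions K0 (affine_action S C))"
    and theta_bilinear: "bounded_bilinear \<theta>"
    and omega_theta: "\<And>\<phi> \<phi>'. omega_bd \<phi> \<phi>' = 1/2 * \<theta> \<phi> \<phi>' - 1/2 * \<theta> \<phi>' \<phi>"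
    and L_closed: "closed (r ` EL_solutions K0 S)"
    and L_lagrangian: "lagrangian_subspace (r ` EL_solutions K0 S)"
    and action_aff: "\<And>\<eta> \<xi>. \<eta> \<in> EL_solutions K0 (affine_action S C) \<Longrightarrow> \<xi> \<in> EL_solutions K0 S \<Longrightarrow>
          affine_action S C (\<eta> + \<xi>) =
            affine_action S C \<eta> - 1/2 * \<theta> (r \<xi>) (r \<xi>) - \<theta> (r \<eta>) (r \<xi>)"
    and action_lin: "\<And>\<xi>. \<xi> \<in> EL_solutions K0 S \<Longrightarrow> S \<xi> = - 1/2 * \<theta> (r \<xi>) (r \<xi>)"

definition vanishes_on_boundary ::
  "'k set \<Rightarrow> ('k \<Rightarrow> 'l) \<Rightarrow> ('l \<Rightarrow> 'l \<Rightarrow> real) \<Rightarrow> 'k \<Rightarrow> bool" where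
  "vanishes_on_boundary K0 r \<theta> \<eta> \<longleftrightarrow> \<eta> \<in> K0 \<and> (\<forall>\<phi>. \<theta> \<phi> (r \<eta>) = 0)"

definition top_dual :: "'l::real_normed_vector set \<Rightarrow> ('l \<Rightarrow> real) set" where
  "top_dual V =
     {f \<in> extensional V. continuous_on V f \<and>
        (\<forall>x\<in>V. \<forall>y\<in>V. f (x + y) = f x + f y) \<and> (\<forall>c. \<forall>x\<in>V. f (c *\<^sub>R x) = c * f x)}"

definition hat_space :: "'l::real_normed_vector set \<Rightarrow> (('l \<Rightarrow> real) \<Rightarrow> real) set" where
  "hat_space V =
     {\<Phi> \<in> extensional (top_dual V).
        (\<forall>f\<in>top_dual V. \<forall>h\<in>top_dual V. \<Phi> (\<lambda>x\<in>V. f x + h x) = \<Phi> f + \<Phi> h) \<and>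
        (\<forall>c. \<forall>f\<in>top_dual V. \<Phi> (\<lambda>x\<in>V. c * f x) = c * \<Phi> f)}"

text \<open>
  The \<open>\<sigma>\<close>-algebra is the one generated by the evaluations at elements of the topological dual. By
  the Riesz representation theorem, the characteristic function below is prescribed on the whole
  topological dual; so it determines the measure and makes it centred Gaussian.
\<close>

definition hat_gaussian ::
  "'l::complex_hilbert_space set \<Rightarrow> (('l \<Rightarrow> real) \<Rightarrow> real) measure \<Rightarrow> bool" where
  "hat_gaussian V \<nu> \<longleftrightarrow>
     prob_space \<nu> \<and>
     sets \<nu> = sets (restrict_space (Pi\<^sub>M (top_dual V) (\<lambda>_. borel)) (hat_space V)) \<and>
     (\<forall>\<xi>\<in>V. (\<integral>\<Phi>. exp (\<i> * of_real (\<Phi> (\<lambda>x\<in>V. g_bd \<xi> x))) \<partial>\<nu>)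
              = complex_of_real (exp (- g_bd \<xi> \<xi>)))"

text \<open>
  Extension of functions from \<open>V\<close> to \<open>hat_space V\<close> by evaluation: if \<open>f\<close> is a function \<open>h\<close> of
  finitely many continuous linear functionals \<open>l \<in> F\<close>, then the extension is the same function of
  the evaluations \<open>\<Phi> l\<close>. The value does not depend on the choice of \<open>F\<close> and \<open>h\<close>, since every
  \<open>\<Phi> \<in> hat_space V\<close> agrees on a finite \<open>F\<close> with the evaluation at some point of \<open>V\<close>. For an \<open>f\<close>
  that is not of this form, \<open>hat_ext V f\<close> has no meaning.
\<close>

definition hat_ext ::
  "'l::real_normed_vector set \<Rightarrow> ('l \<Rightarrow> complex) \<Rightarrow> (('l \<Rightarrow> real) \<Rightarrow> real) \<Rightarrow> complex" where
  "hat_ext V f \<Phi> =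
     (THE v. \<exists>F h. finite F \<and> F \<subseteq> top_dual V \<and>
        (\<forall>x\<in>V. f x = h (\<lambda>l\<in>F. l x)) \<and> v = h (restrict \<Phi> F))"

definition \<alpha>_bd ::
  "('l \<Rightarrow> 'l \<Rightarrow> real) \<Rightarrow> 'l::complex_hilbert_space \<Rightarrow> 'l \<Rightarrow> complex" where
  "\<alpha>_bd \<theta> \<eta> \<phi> = exp (\<i> / 2 * of_real (\<theta> \<eta> (\<phi> - \<eta>)) + \<i> / 2 * of_real (\<theta> \<phi> (\<phi> - \<eta>))
                     - 1 / 4 * of_real (g_bd (\<phi> - \<eta>) (\<phi> - \<eta>)))"

text \<open>The function \<open>\<chi>\<close> with \<open>\<psi> \<phi> = \<chi> (\<phi> - \<eta>) * \<alpha>_bd \<theta> \<eta> \<phi>\<close>.\<close>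

definition \<chi>_of ::
  "('l \<Rightarrow> 'l \<Rightarrow> real) \<Rightarrow> ('l \<Rightarrow> complex) \<Rightarrow> 'l::complex_hilbert_space \<Rightarrow> 'l \<Rightarrow> complex" where
  "\<chi>_of \<theta> \<psi> \<eta> x = \<psi> (x + \<eta>) / \<alpha>_bd \<theta> \<eta> (x + \<eta>)"

definition coherent_state ::
  "('l \<Rightarrow> 'l \<Rightarrow> real) \<Rightarrow> 'l::complex_hilbert_space \<Rightarrow> 'l \<Rightarrow> complex" where
  "coherent_state \<theta> \<xi> \<phi> = exp (1 / 2 * cinner \<xi> \<phi>) * \<alpha>_bd \<theta> 0 \<phi>"

definition linear_amplitude ::
  "'k::real_vector set \<Rightarrow> ('k \<Rightarrow> real) \<Rightarrow> ('k \<Rightarrow> 'l::complex_hilbert_space) \<Rightarrow>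
   ('l \<Rightarrow> 'l \<Rightarrow> real) \<Rightarrow> (('l \<Rightarrow> real) \<Rightarrow> real) measure \<Rightarrow> ('l \<Rightarrow> complex) \<Rightarrow> complex" where
  "linear_amplitude K0 S r \<theta> \<nu> \<psi> =
     (\<integral>\<Phi>. hat_ext (r ` EL_solutions K0 S) (\<chi>_of \<theta> \<psi> 0) \<Phi> \<partial>\<nu>)"

text \<open>
  The definite description singles out the common value over all base points \<open>\<eta>\<close>; it is
  meaningful only where that value does not depend on \<open>\<eta>\<close>.
\<close>

definition affine_amplitude ::
  "'k::real_vector set \<Rightarrow> ('k \<Rightarrow> real) \<Rightarrow> ('k \<Rightarrow> real) \<Rightarrow> ('k \<Rightarrow> 'l::complex_hilbert_space) \<Rightarrow>
   ('l \<Rightarrow> 'l \<Rightarrow> real) \<Rightarrow> (('l \<Rightarrow> real) \<Rightarrow> real) measure \<Rightarrow> ('l \<Rightarrow> complex) \<Rightarrow> complex" where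
  "affine_amplitude K0 S C r \<theta> \<nu> \<psi> =
     (THE v. \<forall>\<eta>\<in>EL_solutions K0 (affine_action S C).
        v = exp (\<i> * of_real (affine_action S C \<eta>)) *
            (\<integral>\<Phi>. hat_ext (r ` EL_solutions K0 S) (\<chi>_of \<theta> \<psi> (r \<eta>)) \<Phi> \<partial>\<nu>))"

end

theory Submission
  imports Defs "HOL-Complex_Analysis.Complex_Analysis"
begin

text \<open>
  Let \<open>\<eta>\<^sub>0\<close> be the solution vanishing on the boundary. Expanding \<open>S(\<eta>\<^sub>0 + \<xi>)\<close> and comparing with the
  boundary formula for the action gives \<open>C \<xi> = - \<theta>(\<eta>\<^sub>0, \<xi>) = - 2 \<omega>(\<eta>\<^sub>0, \<xi>)\<close>, so \<open>C\<close> is represented on \<open>L\<close>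
  by the imaginary part \<open>\<eta>\<^sup>I\<close> common to all of \<open>A\<close>: \<open>C \<xi> = g(\<eta>\<^sup>I, \<xi>)\<close>. The same expansion yields
  \<open>S\<^sup>\<mu>(\<eta>) + \<theta>(\<eta>, \<eta>)/2 = C(\<eta>)/2\<close> for every \<open>\<eta> \<in> A\<close>. With respect to the base point \<open>\<eta>\<close>, the coherent
  state \<open>K\<^sub>\<xi>\<close> is a constant times \<open>exp({\<xi> - \<eta>, \<cdot>}/2)\<close>, the exponential of a complex combination of two
  Gaussian variables, whose integral is \<open>exp((\<bar>a\<bar>\<^sup>2 - \<bar>b\<bar>\<^sup>2 - 2 \<i> g(a, b))/4)\<close> with
  \<open>\<xi> - \<eta> = a + J b\<close>. Collecting exponents gives both formulas.
\<close>

section \<open>Lagrangian decomposition\<close>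

lemma g_bd_eq_inner: "g_bd x y = inner x y"
  by (simp add: g_bd_def inner_eq_Re_cinner)

lemma cinner_add_left: "cinner (x + y) z = cinner x z + cinner y z"
  by (metis cinner_add_right cinner_commute complex_cnj_add)

lemma cinner_scaleC_left: "cinner (c *\<^sub>C x) y = cnj c * cinner x y"
  by (metis cinner_commute cinner_scaleC_right complex_cnj_mult)

lemma cinner_zero_right [simp]: "cinner x 0 = 0"
  using cinner_add_right[of x 0 0] by simp

lemma cinner_diff_left: "cinner (x - y) z = cinner x z - cinner y z"
  using cinner_add_left[of "x - y" y z] by simp

lemma cinner_eq_inner_omega: "cinner x y = Complex (inner x y) (2 * omega_bd x y)"
  by (simp add: inner_eq_Re_cinner omega_bd_def)

lemma omega_J_left: "omega_bd (J_bd x) y = - inner x y / 2"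
  by (simp add: inner_eq_Re_cinner omega_bd_def J_bd_def cinner_scaleC_left)

lemma omega_add_left: "omega_bd (x + y) z = omega_bd x z + omega_bd y z"
  by (simp add: omega_bd_def cinner_add_left add_divide_distrib)

lemma J_bd_J_bd: "J_bd (J_bd x) = - x"
  using scaleR_scaleC[of "-1" x] by (simp add: J_bd_def scaleC_scaleC)

lemma J_bd_add: "J_bd (x + y) = J_bd x + J_bd y"
  by (simp add: J_bd_def scaleC_add_right)

lemma J_bd_diff: "J_bd (x - y) = J_bd x - J_bd y"
  using J_bd_add[of "x - y" y] by simp

lemma J_bd_zero [simp]: "J_bd 0 = 0"
  using J_bd_diff[of 0 0] by simp

lemma J_bd_minus: "J_bd (- x) = - J_bd x"
  using J_bd_diff[of 0 x] by simp

text \<open>A sequence in \<open>V\<close> minimising the squared distance to \<open>x\<close> is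
  Cauchy by the parallelogram law. Its limit attains the infimum \<open>d\<close>, and minimality
  along each line in \<open>V\<close> gives orthogonality.\<close>

lemma orthogonal_projection_exists:
  fixes V :: "'a::{real_inner,complete_space} set"
  assumes V: "subspace V" "closed V"
  obtains v where "v \<in> V" "\<And>w. w \<in> V \<Longrightarrow> inner (x - v) w = 0"
proof -
  define d where "d = (INF v\<in>V. (norm (x - v))\<^sup>2)"
  have ne: "V \<noteq> {}" using subspace_0[OF V(1)] by auto
  have bdd: "bdd_below ((\<lambda>v. (norm (x - v))\<^sup>2) ` V)"
    by (rule bdd_belowI[of _ 0]) auto
  have low: "d \<le> (norm (x - v))\<^sup>2" if "v \<in> V" for v
    unfolding d_def using bdd that by (rule cINF_lower)
  have "\<exists>v\<in>V. (norm (x - v))\<^sup>2 < d + 1 / real (Suc n)" for n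
    using cINF_less_iff[OF ne bdd, of "d + 1 / real (Suc n)"] by (simp add: d_def)
  then obtain v where v: "\<And>n. v n \<in> V" "\<And>n. (norm (x - v n))\<^sup>2 < d + 1 / real (Suc n)"
    by metis
  have dist_v: "(norm (v m - v n))\<^sup>2 < 2 / real (Suc m) + 2 / real (Suc n)" for m n
  proof -
    have "(1/2) *\<^sub>R (v m + v n) \<in> V"
      using V(1) v(1) by (simp add: subspace_add subspace_scale)
    then have "d \<le> (norm (x - (1/2) *\<^sub>R (v m + v n)))\<^sup>2"
      by (rule low)
    \<comment> \<open>Parallelogram law for \<open>x - v m\<close> and \<open>x - v n\<close>. The
      midpoint lies in \<open>V\<close>, so its squared distance to \<open>x\<close> is at least
      \<open>d\<close>.\<close>
    moreover have "(norm (v m - v n))\<^sup>2 =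
        2 * (norm (x - v m))\<^sup>2 + 2 * (norm (x - v n))\<^sup>2 - 4 * (norm (x - (1/2) *\<^sub>R (v m + v n)))\<^sup>2"
      by (simp add: power2_norm_eq_inner inner_diff_left inner_diff_right inner_add_left
          inner_add_right inner_commute algebra_simps)
    ultimately show ?thesis using v(2)[of m] v(2)[of n] by simp
  qed
  have "Cauchy v"
  proof (rule metric_CauchyI)
    fix e :: real assume e: "e > 0"
    obtain N where N: "4 / e\<^sup>2 < real N" using reals_Archimedean2 by blast
    have "dist (v m) (v n) < e" if "m \<ge> N" "n \<ge> N" for m n
    proof -
      have N0: "real N > 0"
        by (rule le_less_trans[OF _ N]) simp
      have "2 / real (Suc m) + 2 / real (Suc n) \<le> 2 / real N + 2 / real N"
        by (intro add_mono divide_left_mono) (use that N0 in auto)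
      also have "\<dots> = 4 / real N" by simp
      also have "\<dots> < e\<^sup>2" using N N0 e by (simp add: field_simps)
      finally have "(norm (v m - v n))\<^sup>2 < e\<^sup>2" using dist_v[of m n] by linarith
      then show ?thesis using e by (simp add: dist_norm power2_less_imp_less)
    qed
    then show "\<exists>M. \<forall>m\<ge>M. \<forall>n\<ge>M. dist (v m) (v n) < e" by blast
  qed
  then obtain u where u: "v \<longlonglongrightarrow> u"
    using Cauchy_convergent convergent_def by blast
  have uV: "u \<in> V" using closed_sequentially[OF V(2)] v(1) u by blast
  have "(\<lambda>n. (norm (x - v n))\<^sup>2) \<longlonglongrightarrow> (norm (x - u))\<^sup>2"
    by (intro tendsto_intros u)
  moreover have "(\<lambda>n. d + 1 / real (Suc n)) \<longlonglongrightarrow> d + 0"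
    using LIMSEQ_inverse_real_of_nat by (intro tendsto_intros) (simp add: divide_inverse)
  ultimately have ud: "(norm (x - u))\<^sup>2 \<le> d"
    using v(2) by (intro LIMSEQ_le[of _ "(norm (x - u))\<^sup>2" _ "d"]) (auto intro: less_imp_le)
  have "inner (x - u) w = 0" if w: "w \<in> V" for w
  proof (cases "w = 0")
    case False
    \<comment> \<open>This \<open>t\<close> minimises the quadratic polynomial giving the squared
      distance from \<open>x\<close> to \<open>u + t *\<^sub>R w\<close>.\<close>
    define t where "t = inner (x - u) w / inner w w"
    have ww: "inner w w > 0" using False by simp
    have "u + t *\<^sub>R w \<in> V" using V(1) uV w by (simp add: subspace_add subspace_scale)
    then have "(norm (x - u))\<^sup>2 \<le> (norm (x - u - t *\<^sub>R w))\<^sup>2"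
      using low[of "u + t *\<^sub>R w"] ud unfolding diff_diff_eq by linarith
    also have "\<dots> = (norm (x - u))\<^sup>2 - 2 * t * inner (x - u) w + t\<^sup>2 * inner w w"
      unfolding power2_norm_eq_inner
      by (simp add: inner_diff_left[of "x - u"] inner_diff_right[of _ "x - u"] inner_commute
          power2_eq_square algebra_simps)
    also have "\<dots> = (norm (x - u))\<^sup>2 - (inner (x - u) w)\<^sup>2 / inner w w"
      using ww by (simp add: t_def field_simps power2_eq_square)
    finally have "(inner (x - u) w)\<^sup>2 / inner w w \<le> 0" by simp
    then show ?thesis using ww by (simp add: divide_le_0_iff)
  qed simp
  with uV that show ?thesis by blast
qed

lemma lagrangian_imp_subspace: "lagrangian_subspace V \<Longrightarrow> subspace V"
  by (simp add: lagrangian_subspace_def)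

lemma lagrangian_omega_eq_0:
  "lagrangian_subspace V \<Longrightarrow> x \<in> V \<Longrightarrow> y \<in> V \<Longrightarrow> omega_bd x y = 0"
  unfolding lagrangian_subspace_def by blast

text \<open>The projection \<open>a\<close> leaves a remainder orthogonal to \<open>V\<close>. Since
  \<open>omega_bd (J_bd z) y\<close> is minus half of \<open>inner z y\<close>, rotating the
  remainder by \<open>J_bd\<close> puts it in the symplectic complement of \<open>V\<close>, which
  is \<open>V\<close> itself.\<close>

lemma lagrangian_decomposition:
  fixes V :: "'l::complex_hilbert_space set"
  assumes V: "lagrangian_subspace V" "closed V"
  obtains a b where "a \<in> V" "b \<in> V" "x = a + J_bd b"
proof -
  from V(1) have "subspace V" by (rule lagrangian_imp_subspace)
  from orthogonal_projection_exists[OF this V(2), of x]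
  obtain a where a: "a \<in> V" "\<And>w. w \<in> V \<Longrightarrow> inner (x - a) w = 0" by blast
  have "omega_bd (- J_bd (x - a)) y = 0" if "y \<in> V" for y
    using a(2)[OF that] by (simp add: J_bd_minus[symmetric] omega_J_left inner_diff_left)
  then have "- J_bd (x - a) \<in> V" using V(1) by (auto simp: lagrangian_subspace_def)
  moreover have "x = a + J_bd (- J_bd (x - a))" by (simp add: J_bd_minus J_bd_J_bd)
  ultimately show ?thesis using a(1) that by blast
qed

text \<open>For \<open>z = b - b'\<close> the vector \<open>J_bd z = a' - a\<close> lies in
  \<open>V\<close>, so \<open>omega_bd (J_bd z) z\<close> vanishes; but it equals minus half the
  squared norm of \<open>z\<close>.\<close>

lemma lagrangian_decomposition_unique:
  fixes V :: "'l::complex_hilbert_space set"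
  assumes V: "lagrangian_subspace V"
    and "a \<in> V" "b \<in> V" "a' \<in> V" "b' \<in> V" "a + J_bd b = a' + J_bd b'"
  shows "b = b'"
proof -
  have s: "subspace V" using V by (rule lagrangian_imp_subspace)
  have e: "J_bd (b - b') = a' - a" using assms(6) by (simp add: J_bd_diff algebra_simps)
  have "omega_bd (J_bd (b - b')) (b - b') = 0"
    unfolding e using assms s by (intro lagrangian_omega_eq_0[OF V] subspace_diff)
  then show ?thesis by (simp add: omega_J_left)
qed

section \<open>Extension to the algebraic dual\<close>

lemma top_dual_add:
  assumes "subspace V" "f \<in> top_dual V" "h \<in> top_dual V"
  shows "(\<lambda>x\<in>V. f x + h x) \<in> top_dual V"
proof -
  have "continuous_on V (\<lambda>x\<in>V. f x + h x) = continuous_on V (\<lambda>x. f x + h x)"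
    by (rule continuous_on_cong) auto
  then show ?thesis using assms
    by (auto simp: top_dual_def subspace_def algebra_simps intro!: continuous_on_add)
qed

lemma top_dual_scale:
  assumes "subspace V" "f \<in> top_dual V"
  shows "(\<lambda>x\<in>V. c * f x) \<in> top_dual V"
proof -
  have "continuous_on V (\<lambda>x\<in>V. c * f x) = continuous_on V (\<lambda>x. c * f x)"
    by (rule continuous_on_cong) auto
  then show ?thesis using assms
    by (auto simp: top_dual_def subspace_def algebra_simps intro!: continuous_on_mult_left)
qed

lemma top_dual_inner:
  assumes "subspace V"
  shows "(\<lambda>x\<in>V. inner a x) \<in> top_dual V"
proof -
  have "continuous_on V (\<lambda>x\<in>V. inner a x) = continuous_on V (\<lambda>x. inner a x)"
    by (rule continuous_on_cong) auto
  then show ?thesis using assms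
    by (auto simp: top_dual_def subspace_def inner_add_right intro!: continuous_intros)
qed

lemma top_dual_apply_lincomb:
  assumes "subspace V" "l \<in> top_dual V" "x \<in> V" "y \<in> V"
  shows "l (x + c *\<^sub>R y) = l x + c * l y"
  using assms by (simp add: top_dual_def subspace_scale)

lemma hat_space_add:
  "\<Phi> \<in> hat_space V \<Longrightarrow> f \<in> top_dual V \<Longrightarrow> h \<in> top_dual V \<Longrightarrow> \<Phi> (\<lambda>x\<in>V. f x + h x) = \<Phi> f + \<Phi> h"
  by (simp add: hat_space_def)

lemma hat_space_scale:
  "\<Phi> \<in> hat_space V \<Longrightarrow> f \<in> top_dual V \<Longrightarrow> \<Phi> (\<lambda>x\<in>V. c * f x) = c * \<Phi> f"
  by (simp add: hat_space_def)

lemma hat_space_lincomb: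
  assumes "subspace V" "\<Phi> \<in> hat_space V" "f \<in> top_dual V" "h \<in> top_dual V"
  shows "\<Phi> (\<lambda>x\<in>V. f x + c * h x) = \<Phi> f + c * \<Phi> h"
proof -
  have "(\<lambda>x\<in>V. f x + c * h x) = (\<lambda>x\<in>V. f x + (\<lambda>x\<in>V. c * h x) x)"
    by (rule restrict_ext) simp
  then show ?thesis
    using assms by (simp only: hat_space_add hat_space_scale top_dual_scale)
qed

lemma hat_space_inner_lincomb:
  assumes "subspace V" "\<Phi> \<in> hat_space V"
  shows "\<Phi> (\<lambda>x\<in>V. inner (s *\<^sub>R a + t *\<^sub>R b) x) = s * \<Phi> (\<lambda>x\<in>V. inner a x) + t * \<Phi> (\<lambda>x\<in>V. inner b x)"
proof -
  let ?a = "\<lambda>x\<in>V. inner a x" and ?b = "\<lambda>x\<in>V. inner b x"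
  have "(\<lambda>x\<in>V. inner (s *\<^sub>R a + t *\<^sub>R b) x) = (\<lambda>x\<in>V. (\<lambda>x\<in>V. s * ?a x) x + t * ?b x)"
    by (rule restrict_ext) (simp add: inner_add_left)
  then show ?thesis
    using assms by (simp only: hat_space_lincomb hat_space_scale top_dual_scale top_dual_inner)
qed

text \<open>A functional vanishing on the common kernel of a finite \<open>F\<close> is a linear
  combination of \<open>F\<close>, so any \<Phi> that evaluates \<open>F\<close> at \<open>x\<close>
  also evaluates \<open>m\<close> at \<open>x\<close>. The induction builds the combination by
  peeling off one functional at a time, hence the generalisation over \<open>m\<close>.\<close>

lemma hat_space_eval_of_kernel:
  assumes V: "subspace V" and \<Phi>: "\<Phi> \<in> hat_space V" and x: "x \<in> V"
    and "finite F" "F \<subseteq> top_dual V" "m \<in> top_dual V"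
    and "\<And>y. y \<in> V \<Longrightarrow> (\<And>l. l \<in> F \<Longrightarrow> l y = 0) \<Longrightarrow> m y = 0"
    and "\<And>l. l \<in> F \<Longrightarrow> \<Phi> l = l x"
  shows "\<Phi> m = m x"
  using assms(4-)
proof (induction F arbitrary: m rule: finite_induct)
  case empty
  then have m0: "m y = 0" if "y \<in> V" for y using that by simp
  then have "m = (\<lambda>x\<in>V. 0 * m x)"
    using empty(2) by (auto simp: top_dual_def intro: extensionalityI)
  then have "\<Phi> m = 0" using hat_space_scale[OF \<Phi> empty(2), of 0] by simp
  then show ?case using m0[OF x] by simp
next
  case (insert n F)
  have n: "n \<in> top_dual V" using insert.prems by simp
  show ?case
  proof (cases "\<exists>y\<in>V. (\<forall>l\<in>F. l y = 0) \<and> n y \<noteq> 0")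
    case False
    \<comment> \<open>Here \<open>n\<close> vanishes on the common kernel of \<open>F\<close>, so
      dropping it leaves the kernel unchanged.\<close>
    show ?thesis
    proof (rule insert.IH)
      fix y assume "y \<in> V" "\<And>l. l \<in> F \<Longrightarrow> l y = 0"
      with False show "m y = 0" by (intro insert.prems(3)) auto
    qed (use insert.prems in auto)
  next
    case True
    then obtain y where y: "y \<in> V" "\<And>l. l \<in> F \<Longrightarrow> l y = 0" "n y \<noteq> 0" by blast
    \<comment> \<open>Chosen so that \<open>m + c * n\<close> vanishes at \<open>y\<close>.\<close>
    define c where "c = - m y / n y"
    let ?m = "\<lambda>x\<in>V. m x + c * n x"
    have m': "?m \<in> top_dual V"
    proof -
      have "?m = (\<lambda>x\<in>V. m x + (\<lambda>x\<in>V. c * n x) x)" by (rule restrict_ext) simp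
      then show ?thesis using V n insert.prems(2) by (simp only: top_dual_add top_dual_scale)
    qed
    have "\<Phi> ?m = ?m x"
    proof (rule insert.IH[OF _ m'])
      fix z assume z: "z \<in> V" "\<And>l. l \<in> F \<Longrightarrow> l z = 0"
      \<comment> \<open>Moving \<open>z\<close> along \<open>y\<close> makes \<open>n\<close> vanish
        without disturbing \<open>F\<close>; on the result the hypothesis on \<open>m\<close>
        applies.\<close>
      let ?w = "z + (- n z / n y) *\<^sub>R y"
      have wV: "?w \<in> V"
        using V z y by (blast intro: subspace_add subspace_scale)
      have lin: "l ?w = l z + (- n z / n y) * l y" if "l \<in> top_dual V" for l
        by (rule top_dual_apply_lincomb[OF V that z(1) y(1)])
      have "m ?w = 0"
      proof (rule insert.prems(3)[OF wV])
        fix l assume l: "l \<in> insert n F"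
        then have "l \<in> top_dual V" using insert.prems(1) by blast
        from lin[OF this] l show "l ?w = 0" using y(2)[of l] y(3) z(2)[of l] by auto
      qed
      then show "?m z = 0"
        using lin[OF insert.prems(2)] z(1) y(3) by (simp add: c_def field_simps)
    qed (use insert.prems in auto)
    moreover have "\<Phi> ?m = \<Phi> m + c * \<Phi> n"
      by (rule hat_space_lincomb) (use V \<Phi> n insert.prems in auto)
    ultimately show ?thesis using x insert.prems(4)[of n] by simp
  qed
qed

text \<open>Functionals are added one by one. If \<open>n\<close> vanishes on the common kernel of
  the earlier ones, its value is already forced; otherwise the point can be shifted inside that
  kernel until \<open>n\<close> takes the value prescribed by \<Phi>.\<close>

lemma hat_space_interpolation:
  assumes V: "subspace V" and \<Phi>: "\<Phi> \<in> hat_space V"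
    and F: "finite F" "F \<subseteq> top_dual V"
  obtains x where "x \<in> V" "\<And>l. l \<in> F \<Longrightarrow> \<Phi> l = l x"
proof -
  have "\<exists>x\<in>V. \<forall>l\<in>F. \<Phi> l = l x"
    using F
  proof (induction F rule: finite_induct)
    case empty
    then show ?case using subspace_0[OF V] by auto
  next
    case (insert n F)
    then obtain x where x: "x \<in> V" "\<And>l. l \<in> F \<Longrightarrow> \<Phi> l = l x" by auto
    show ?case
    proof (cases "\<exists>y\<in>V. (\<forall>l\<in>F. l y = 0) \<and> n y \<noteq> 0")
      case False
      have "\<Phi> n = n x"
        by (rule hat_space_eval_of_kernel[OF V \<Phi> x(1) insert.hyps(1)])
           (use False insert.prems x in auto)
      then show ?thesis using x by auto
    next
      case True
      then obtain y where y: "y \<in> V" "\<And>l. l \<in> F \<Longrightarrow> l y = 0" "n y \<noteq> 0" by blast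
      let ?w = "x + ((\<Phi> n - n x) / n y) *\<^sub>R y"
      have wV: "?w \<in> V"
        using V x y by (blast intro: subspace_add subspace_scale)
      have lin: "l ?w = l x + ((\<Phi> n - n x) / n y) * l y" if "l \<in> top_dual V" for l
        by (rule top_dual_apply_lincomb[OF V that x(1) y(1)])
      have "\<Phi> l = l ?w" if l: "l \<in> insert n F" for l
      proof -
        have "l \<in> top_dual V" using insert.prems l by blast
        from lin[OF this] l show ?thesis using x(2)[of l] y(2)[of l] y(3) by auto
      qed
      then show ?thesis using wV by blast
    qed
  qed
  then show ?thesis using that by blast
qed

text \<open>Makes the definite description usable: given two representations of \<open>f\<close>,
  over \<open>F\<close> and over \<open>G\<close>, interpolation of \<Phi> on their union yields one
  point \<open>x\<close> of \<open>V\<close> at which both candidate values equal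
  \<open>f x\<close>.\<close>

lemma hat_ext_eq:
  assumes V: "subspace V" and \<Phi>: "\<Phi> \<in> hat_space V"
    and F: "finite F" "F \<subseteq> top_dual V"
    and f: "\<And>x. x \<in> V \<Longrightarrow> f x = h (\<lambda>l\<in>F. l x)"
  shows "hat_ext V f \<Phi> = h (restrict \<Phi> F)"
  unfolding hat_ext_def
proof (rule the_equality)
  show "\<exists>G k. finite G \<and> G \<subseteq> top_dual V \<and> (\<forall>x\<in>V. f x = k (\<lambda>l\<in>G. l x)) \<and>
      h (restrict \<Phi> F) = k (restrict \<Phi> G)"
    using F f by blast
next
  fix v assume "\<exists>G k. finite G \<and> G \<subseteq> top_dual V \<and> (\<forall>x\<in>V. f x = k (\<lambda>l\<in>G. l x)) \<and>
      v = k (restrict \<Phi> G)"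
  then obtain G k where G: "finite G" "G \<subseteq> top_dual V" "\<And>x. x \<in> V \<Longrightarrow> f x = k (\<lambda>l\<in>G. l x)"
    and v: "v = k (restrict \<Phi> G)" by blast
  obtain x where x: "x \<in> V" "\<And>l. l \<in> F \<union> G \<Longrightarrow> \<Phi> l = l x"
    using hat_space_interpolation[OF V \<Phi>, of "F \<union> G"] F G by auto
  have "restrict \<Phi> F = (\<lambda>l\<in>F. l x)" "restrict \<Phi> G = (\<lambda>l\<in>G. l x)"
    using x(2) by (auto intro: restrict_ext)
  then show "v = h (restrict \<Phi> F)" using v f[OF x(1)] G(3)[OF x(1)] by simp
qed

section \<open>Gaussian integrals\<close>

lemma integrable_exp_abs_std_normal:
  "integrable std_normal_distribution (\<lambda>x. exp (t * \<bar>x\<bar>))"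
proof -
  have *: "integrable std_normal_distribution (\<lambda>x. exp (s * x))" for s :: real
  proof -
    \<comment> \<open>Completing the square turns the product into a multiple of the normal density
      with mean \<open>s\<close>.\<close>
    have "std_normal_density x * exp (s * x) = exp (s\<^sup>2 / 2) * normal_density s 1 x" for x
      unfolding normal_density_def
      by (simp add: exp_add[symmetric] power2_eq_square field_simps)
    then show ?thesis
      by (subst integrable_density) (auto intro!: integrable_mult_right integrable_normal_density)
  qed
  have "integrable std_normal_distribution (\<lambda>x. exp (t * x) + exp (- t * x))"
    by (intro Bochner_Integration.integrable_add *)
  then show ?thesis
  proof (rule Bochner_Integration.integrable_bound)
    have "exp (t * \<bar>x\<bar>) \<le> exp (t * x) + exp (- t * x)" for x
      by (cases "x < 0") (auto simp: add_increasing add_increasing2)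
    then show "AE x in std_normal_distribution.
        norm (exp (t * \<bar>x\<bar>)) \<le> norm (exp (t * x) + exp (- t * x))"
      by (intro AE_I2) (metis abs_ge_self abs_exp_cancel order_trans real_norm_def)
  qed simp
qed

text \<open>By Levy uniqueness the characteristic function forces the law of \<open>X\<close> to be
  standard normal, and exponential moments depend only on the law.\<close>

lemma (in prob_space) integrable_exp_abs_of_gaussian_char:
  fixes X :: "'a \<Rightarrow> real"
  assumes [measurable]: "X \<in> borel_measurable M"
    and ch: "\<And>s. (\<integral>\<omega>. exp (\<i> * of_real (s * X \<omega>)) \<partial>M) = complex_of_real (exp (- s\<^sup>2 / 2))"
  shows "integrable M (\<lambda>\<omega>. exp (t * \<bar>X \<omega>\<bar>))"
proof -
  have "distr M borel X = std_normal_distribution"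
  proof (rule Levy_uniqueness)
    show "real_distribution (distr M borel X)"
      by (rule real_distribution_distr) simp
    show "real_distribution std_normal_distribution"
      by (rule real_dist_normal_dist)
    show "char (distr M borel X) = char std_normal_distribution"
      by (rule ext) (use ch in \<open>simp add: char_std_normal_distribution char_def integral_distr\<close>)
  qed
  then have "integrable (distr M borel X) (\<lambda>x. exp (t * \<bar>x\<bar>))"
    using integrable_exp_abs_std_normal by simp
  then show ?thesis by (subst (asm) integrable_distr_eq) auto
qed

text \<open>
  The moments of \<open>X\<close> against \<open>exp (\<i> * Y)\<close> are the coefficients of an entire function of \<open>z\<close>,
  which the joint characteristic function determines on the imaginary axis.
\<close>

lemma (in prob_space) gaussian_complex_exp_integral:
  fixes X Y :: "'a \<Rightarrow> real" and z :: complex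
  assumes [measurable]: "X \<in> borel_measurable M" "Y \<in> borel_measurable M"
    and ch: "\<And>s. (\<integral>\<omega>. exp (\<i> * of_real (s * X \<omega>)) \<partial>M) = complex_of_real (exp (- s\<^sup>2 / 2))"
    and joint: "\<And>s. (\<integral>\<omega>. exp (\<i> * of_real (s * X \<omega> + Y \<omega>)) \<partial>M) = complex_of_real (exp (- s\<^sup>2 / 2 - s * c - d))"
  shows "(\<integral>\<omega>. exp (z * of_real (X \<omega>) + \<i> * of_real (Y \<omega>)) \<partial>M) = exp (z\<^sup>2 / 2 + \<i> * z * of_real c - of_real d)"
proof -
  \<comment> \<open>\<open>H\<close> is the wanted integral as a function of the complex parameter;
    the \<open>a n\<close> below are its Taylor coefficients at 0.\<close>
  define H where "H z = (\<integral>\<omega>. exp (z * of_real (X \<omega>) + \<i> * of_real (Y \<omega>)) \<partial>M)" for z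
  define a where "a n = (\<integral>\<omega>. of_real (X \<omega>) ^ n / fact n * exp (\<i> * of_real (Y \<omega>)) \<partial>M)" for n
  have series: "(\<lambda>n. a n * (w - 0) ^ n) sums H w" for w
  proof -
    define f where "f n \<omega> = (w * of_real (X \<omega>)) ^ n / fact n * exp (\<i> * of_real (Y \<omega>))" for n \<omega>
    have [measurable]: "f n \<in> borel_measurable M" for n unfolding f_def by measurable
    have nf: "norm (f n \<omega>) = (norm w * \<bar>X \<omega>\<bar>) ^ n /\<^sub>R fact n" for n \<omega>
      by (simp add: f_def norm_mult norm_divide norm_power power_mult_distrib divide_inverse_commute norm_inverse
          del: times_divide_eq_right)
    have ex: "(\<lambda>n. norm (f n \<omega>)) sums exp (norm w * \<bar>X \<omega>\<bar>)" for \<omega>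
      unfolding nf by (rule exp_converges)
    \<comment> \<open>One integrable function dominates all partial sums of norms, which licenses
      exchanging sum and integral.\<close>
    have dom: "integrable M (\<lambda>\<omega>. exp (norm w * \<bar>X \<omega>\<bar>))"
      by (rule integrable_exp_abs_of_gaussian_char[OF assms(1) ch])
    have part: "(\<Sum>n<N. norm (f n \<omega>)) \<le> exp (norm w * \<bar>X \<omega>\<bar>)" for N \<omega>
      unfolding sums_unique[OF ex[of \<omega>]]
      by (rule sum_le_suminf[OF sums_summable[OF ex]]) auto
    have intf: "integrable M (f n)" for n
    proof (rule Bochner_Integration.integrable_bound[OF dom])
      have "norm (f n \<omega>) \<le> exp (norm w * \<bar>X \<omega>\<bar>)" for \<omega>
        by (rule order_trans[OF _ part[of \<omega> "Suc n"]], rule member_le_sum) auto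
      then show "AE \<omega> in M. norm (f n \<omega>) \<le> norm (exp (norm w * \<bar>X \<omega>\<bar>))" by simp
    qed simp
    have "(\<lambda>n. integral\<^sup>L M (f n)) sums (\<integral>\<omega>. (\<Sum>n. f n \<omega>) \<partial>M)"
    proof (rule sums_integral[OF intf])
      show "AE \<omega> in M. summable (\<lambda>n. norm (f n \<omega>))" by (rule AE_I2) (rule sums_summable[OF ex])
      show "summable (\<lambda>n. \<integral>\<omega>. norm (f n \<omega>) \<partial>M)"
      proof (rule summableI_nonneg_bounded)
        fix N
        have "(\<Sum>n<N. \<integral>\<omega>. norm (f n \<omega>) \<partial>M) = (\<integral>\<omega>. (\<Sum>n<N. norm (f n \<omega>)) \<partial>M)"
          using intf by simp
        also have "\<dots> \<le> (\<integral>\<omega>. exp (norm w * \<bar>X \<omega>\<bar>) \<partial>M)"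
          using intf part by (intro integral_mono dom) auto
        finally show "(\<Sum>n<N. \<integral>\<omega>. norm (f n \<omega>) \<partial>M) \<le> (\<integral>\<omega>. exp (norm w * \<bar>X \<omega>\<bar>) \<partial>M)" .
      qed simp
    qed
    moreover have "(\<Sum>n. f n \<omega>) = exp (w * of_real (X \<omega>) + \<i> * of_real (Y \<omega>))" for \<omega>
    proof -
      have "(\<lambda>n. f n \<omega>) sums (exp (w * of_real (X \<omega>)) * exp (\<i> * of_real (Y \<omega>)))"
        unfolding f_def using exp_converges[of "w * of_real (X \<omega>)"]
        by (intro sums_mult2) (simp add: scaleR_conv_of_real divide_inverse mult.commute)
      then show ?thesis by (simp add: sums_iff exp_add)
    qed
    moreover have "integral\<^sup>L M (f n) = a n * (w - 0) ^ n" for n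
    proof -
      have "f n = (\<lambda>\<omega>. w ^ n * (of_real (X \<omega>) ^ n / fact n * exp (\<i> * of_real (Y \<omega>))))"
        by (simp add: f_def power_mult_distrib fun_eq_iff)
      then have "integral\<^sup>L M (f n) = w ^ n * a n"
        unfolding a_def by (simp only: integral_mult_right_zero)
      then show ?thesis by simp
    qed
    ultimately show ?thesis by (simp add: H_def)
  qed
  \<comment> \<open>The claimed value, also holomorphic. The ball contains both the target
    \<open>z\<close> and a piece of the imaginary axis around 0, where \<open>joint\<close> gives
    equality.\<close>
  define G where "G z = exp (z\<^sup>2 / 2 + \<i> * z * of_real c - of_real d)" for z
  let ?B = "ball 0 (norm z + 1) :: complex set"
  have "H holomorphic_on ?B" by (rule power_series_holomorphic[OF series])
  then have hol: "(\<lambda>z. H z - G z) holomorphic_on ?B"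
    unfolding G_def by (intro holomorphic_intros) auto
  have imag: "H (\<i> * of_real s) = G (\<i> * of_real s)" for s
  proof -
    have "H (\<i> * of_real s) = (\<integral>\<omega>. exp (\<i> * of_real (s * X \<omega> + Y \<omega>)) \<partial>M)"
      by (simp add: H_def algebra_simps)
    also have "\<dots> = G (\<i> * of_real s)"
      unfolding joint G_def exp_of_real[symmetric]
      by (intro arg_cong[of _ _ exp]) (simp add: power2_eq_square algebra_simps)
    finally show ?thesis .
  qed
  let ?U = "?B \<inter> range (\<lambda>s. \<i> * complex_of_real s)"
  have "0 islimpt ?U"
    unfolding islimpt_approachable
  proof (intro allI impI)
    fix e :: real assume e: "e > 0"
    \<comment> \<open>The bound 1/2 keeps the point inside the ball, whose radius is at least
      1.\<close>
    define s where "s = min (e / 2) (1 / 2)"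
    have s: "0 < s" "s < e" "s \<le> 1 / 2"
      using e by (auto simp: s_def)
    have "s < norm z + 1" using s(3) norm_ge_zero[of z] by linarith
    note s = s this
    then show "\<exists>x'\<in>?U. x' \<noteq> 0 \<and> dist x' 0 < e"
      by (intro bexI[of _ "\<i> * of_real s"]) (auto simp: norm_mult)
  qed
  from analytic_continuation[OF hol open_ball connected_ball _ _ this, of z]
  have "H z - G z = 0" using imag by (auto simp: add_pos_nonneg add.commute)
  then show ?thesis by (simp add: H_def G_def)
qed

section \<open>Exponential integrals against the Gaussian measure on the algebraic dual\<close>

lemma space_hat_gaussian:
  assumes "hat_gaussian V \<nu>"
  shows "space \<nu> = hat_space V"
proof -
  have "space \<nu> = space (restrict_space (Pi\<^sub>M (top_dual V) (\<lambda>_. borel)) (hat_space V))"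
    using assms by (intro sets_eq_imp_space_eq) (simp add: hat_gaussian_def)
  also have "\<dots> = hat_space V"
    by (auto simp: space_restrict_space space_PiM hat_space_def PiE_def)
  finally show ?thesis .
qed

lemma measurable_hat_eval:
  assumes "hat_gaussian V \<nu>" "l \<in> top_dual V"
  shows "(\<lambda>\<Phi>. \<Phi> l) \<in> borel_measurable \<nu>"
proof -
  have "(\<lambda>\<Phi>. \<Phi> l) \<in> borel_measurable (restrict_space (Pi\<^sub>M (top_dual V) (\<lambda>_. borel)) (hat_space V))"
    by (intro measurable_restrict_space1 measurable_component_singleton assms)
  then show ?thesis
    using assms(1) measurable_cong_sets by (auto simp: hat_gaussian_def)
qed

text \<open>The characteristic function of \<nu> at \<open>s *\<^sub>R a + t *\<^sub>R b\<close> is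
  the joint characteristic function of the evaluations at \<open>a\<close> and \<open>b\<close>,
  whose covariance is twice the inner product. Normalising the first evaluation reduces the claim to
  \<open>gaussian_complex_exp_integral\<close>; this needs a nonzero \<open>a\<close>, so
  \<open>a = 0\<close> is treated apart.\<close>

lemma hat_gaussian_exp_integral:
  assumes V: "subspace V" and \<nu>: "hat_gaussian V \<nu>" and ab: "a \<in> V" "b \<in> V"
  shows "(\<integral>\<Phi>. exp (of_real (\<Phi> (\<lambda>x\<in>V. inner a x)) + \<i> * of_real (\<Phi> (\<lambda>x\<in>V. inner b x))) \<partial>\<nu>) =
    exp (of_real (inner a a) - of_real (inner b b) + 2 * \<i> * of_real (inner a b))"
proof -
  let ?l = "\<lambda>a. \<lambda>x\<in>V. inner a x"
  interpret prob_space \<nu> using \<nu> by (simp add: hat_gaussian_def)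
  have meas [measurable]: "(\<lambda>\<Phi>. \<Phi> (?l a)) \<in> borel_measurable \<nu>" for a
    by (rule measurable_hat_eval[OF \<nu> top_dual_inner[OF V]])
  have char_lincomb: "(\<integral>\<Phi>. exp (\<i> * of_real (s * \<Phi> (?l a) + t * \<Phi> (?l b))) \<partial>\<nu>) =
      complex_of_real (exp (- (s\<^sup>2 * inner a a + 2 * s * t * inner a b + t\<^sup>2 * inner b b)))" for s t
  proof -
    let ?u = "s *\<^sub>R a + t *\<^sub>R b"
    have u: "?u \<in> V" using V ab by (intro subspace_add subspace_scale)
    have "(\<integral>\<Phi>. exp (\<i> * of_real (s * \<Phi> (?l a) + t * \<Phi> (?l b))) \<partial>\<nu>) =
        (\<integral>\<Phi>. exp (\<i> * of_real (\<Phi> (?l ?u))) \<partial>\<nu>)"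
      by (rule Bochner_Integration.integral_cong[OF refl])
         (simp only: space_hat_gaussian[OF \<nu>] hat_space_inner_lincomb[OF V])
    also have "\<dots> = complex_of_real (exp (- inner ?u ?u))"
      using \<nu> u by (simp add: hat_gaussian_def g_bd_eq_inner)
    also have "inner ?u ?u = s\<^sup>2 * inner a a + 2 * s * t * inner a b + t\<^sup>2 * inner b b"
      by (simp add: inner_add_left inner_add_right inner_commute power2_eq_square algebra_simps)
    finally show ?thesis .
  qed
  show ?thesis
  proof (cases "a = 0")
    case True
    have "(\<integral>\<Phi>. exp (of_real (\<Phi> (?l a)) + \<i> * of_real (\<Phi> (?l b))) \<partial>\<nu>) =
        (\<integral>\<Phi>. exp (\<i> * of_real (0 * \<Phi> (?l a) + 1 * \<Phi> (?l b))) \<partial>\<nu>)"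
    proof (rule Bochner_Integration.integral_cong[OF refl])
      fix \<Phi> assume "\<Phi> \<in> space \<nu>"
      then have "\<Phi> (?l a) = 0"
        using hat_space_inner_lincomb[OF V, of \<Phi> 0 0 0 0] True by (simp add: space_hat_gaussian[OF \<nu>])
      then show "exp (of_real (\<Phi> (?l a)) + \<i> * of_real (\<Phi> (?l b))) =
          exp (\<i> * of_real (0 * \<Phi> (?l a) + 1 * \<Phi> (?l b)))" by simp
    qed
    also have "\<dots> = exp (- of_real (inner b b))"
      unfolding char_lincomb by (simp add: exp_of_real[symmetric])
    finally show ?thesis using True by simp
  next
    case False
    \<comment> \<open>The standard deviation of the evaluation at \<open>a\<close>.\<close>
    define \<sigma> where "\<sigma> = sqrt 2 * norm a"
    have \<sigma>: "\<sigma> > 0" "\<sigma>\<^sup>2 = 2 * inner a a"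
      using False by (simp_all add: \<sigma>_def power_mult_distrib power2_norm_eq_inner)
    \<comment> \<open>Instance with \<open>z\<close> equal to \<sigma>, \<open>c\<close> the
      covariance of the normalised variable with the evaluation at \<open>b\<close>, and
      \<open>d\<close> half the variance of the latter.\<close>
    have "(\<integral>\<Phi>. exp (of_real \<sigma> * of_real (\<Phi> (?l a) / \<sigma>) + \<i> * of_real (\<Phi> (?l b))) \<partial>\<nu>) =
      exp ((of_real \<sigma>)\<^sup>2 / 2 + \<i> * of_real \<sigma> * of_real (2 * inner a b / \<sigma>) - of_real (inner b b))"
    proof (rule gaussian_complex_exp_integral)
      fix s
      have *: "s * (p / \<sigma>) + q = (s / \<sigma>) * p + 1 * q" for p q
        by simp
      have **: "(s / \<sigma>)\<^sup>2 * inner a a = s\<^sup>2 / 2"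
        using \<sigma> False by (simp add: power_divide field_simps)
      show "(\<integral>\<Phi>. exp (\<i> * of_real (s * (\<Phi> (?l a) / \<sigma>))) \<partial>\<nu>) = complex_of_real (exp (- s\<^sup>2 / 2))"
      proof -
        have "(\<integral>\<Phi>. exp (\<i> * of_real (s * (\<Phi> (?l a) / \<sigma>))) \<partial>\<nu>) =
            (\<integral>\<Phi>. exp (\<i> * of_real (s / \<sigma> * \<Phi> (?l a) + 0 * \<Phi> (?l b))) \<partial>\<nu>)"
          by simp
        also have "\<dots> = complex_of_real (exp (- s\<^sup>2 / 2))" unfolding char_lincomb ** by simp
        finally show ?thesis .
      qed
      show "(\<integral>\<Phi>. exp (\<i> * of_real (s * (\<Phi> (?l a) / \<sigma>) + \<Phi> (?l b))) \<partial>\<nu>) =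
          complex_of_real (exp (- s\<^sup>2 / 2 - s * (2 * inner a b / \<sigma>) - inner b b))"
        unfolding * char_lincomb ** by (simp add: algebra_simps)
    qed measurable
    moreover have "complex_of_real \<sigma> * of_real (x / \<sigma>) = of_real x" for x
      using \<sigma>(1) by simp
    moreover have "(complex_of_real \<sigma>)\<^sup>2 / 2 = of_real (inner a a)"
      unfolding of_real_power[symmetric] \<sigma>(2) by simp
    ultimately show ?thesis using \<sigma>(1) by (simp add: mult.assoc algebra_simps)
  qed
qed

lemma cinner_lagrangian_real:
  "lagrangian_subspace V \<Longrightarrow> x \<in> V \<Longrightarrow> y \<in> V \<Longrightarrow> cinner x y = of_real (inner x y)"
  by (simp add: cinner_eq_inner_omega lagrangian_omega_eq_0 complex_eq_iff)

lemma cinner_lagrangian: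
  assumes "lagrangian_subspace V" "a \<in> V" "b \<in> V" "x \<in> V"
  shows "cinner (a + J_bd b) x = of_real (inner a x) - \<i> * of_real (inner b x)"
  using assms(2-) by (simp add: cinner_add_left J_bd_def cinner_scaleC_left cinner_lagrangian_real[OF assms(1)])

text \<open>On \<open>V\<close> the inner product is real, so the integrand depends on
  \<open>x\<close> only through two real functionals. This gives \<open>hat_ext\<close> a finite
  representation and leaves a Gaussian integral.\<close>

lemma integral_hat_ext_exp_cinner:
  assumes L: "lagrangian_subspace V" and \<nu>: "hat_gaussian V \<nu>" and ab: "a \<in> V" "b \<in> V"
  shows "(\<integral>\<Phi>. hat_ext V (\<lambda>x. k * exp (1 / 2 * cinner (a + J_bd b) x)) \<Phi> \<partial>\<nu>) =
    k * exp (1 / 4 * of_real (inner a a) - 1 / 4 * of_real (inner b b) - \<i> / 2 * of_real (inner a b))"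
proof -
  let ?l = "\<lambda>a. \<lambda>x\<in>V. inner a x"
  \<comment> \<open>The halves come from the exponent of the coherent state, the sign from conjugate
    linearity in the first argument.\<close>
  let ?a = "(1/2) *\<^sub>R a" and ?b = "(-1/2) *\<^sub>R b"
  have V: "subspace V" using L by (rule lagrangian_imp_subspace)
  have "hat_ext V (\<lambda>x. k * exp (1 / 2 * cinner (a + J_bd b) x)) \<Phi> =
      k * exp (of_real (\<Phi> (?l ?a)) + \<i> * of_real (\<Phi> (?l ?b)))" if "\<Phi> \<in> hat_space V" for \<Phi>
  proof -
    have "hat_ext V (\<lambda>x. k * exp (1 / 2 * cinner (a + J_bd b) x)) \<Phi> =
        (\<lambda>p. k * exp (of_real (p (?l ?a)) + \<i> * of_real (p (?l ?b)))) (restrict \<Phi> {?l ?a, ?l ?b})"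
    proof (rule hat_ext_eq[OF V that])
      show "{?l ?a, ?l ?b} \<subseteq> top_dual V" using top_dual_inner[OF V] by blast
    next
      fix x assume "x \<in> V"
      then show "k * exp (1 / 2 * cinner (a + J_bd b) x) =
          k * exp (of_real ((\<lambda>l\<in>{?l ?a, ?l ?b}. l x) (?l ?a)) + \<i> * of_real ((\<lambda>l\<in>{?l ?a, ?l ?b}. l x) (?l ?b)))"
        by (simp add: cinner_lagrangian[OF L ab] algebra_simps)
    qed simp
    then show ?thesis by simp
  qed
  then have "(\<integral>\<Phi>. hat_ext V (\<lambda>x. k * exp (1 / 2 * cinner (a + J_bd b) x)) \<Phi> \<partial>\<nu>) =
      (\<integral>\<Phi>. k * exp (of_real (\<Phi> (?l ?a)) + \<i> * of_real (\<Phi> (?l ?b))) \<partial>\<nu>)"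
    by (intro Bochner_Integration.integral_cong) (auto simp: space_hat_gaussian[OF \<nu>])
  also have "\<dots> = k * exp (of_real (inner ?a ?a) - of_real (inner ?b ?b) + 2 * \<i> * of_real (inner ?a ?b))"
    by (simp only: integral_mult_right_zero
        hat_gaussian_exp_integral[OF V \<nu> subspace_scale[OF V ab(1)] subspace_scale[OF V ab(2)]])
  finally show ?thesis by simp
qed

section \<open>Amplitudes\<close>

context affine_field_theory
begin

lemmas theta_simps =
  bounded_bilinear.add_left[OF theta_bilinear] bounded_bilinear.add_right[OF theta_bilinear]
  bounded_bilinear.zero_left[OF theta_bilinear] bounded_bilinear.zero_right[OF theta_bilinear]

text \<open>In the quotient of exponentials the terms quadratic in \<open>x\<close> cancel. The
  mixed \<theta> terms combine to the symplectic form of \<eta> and \<open>x\<close>, which joins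
  the mixed real inner product to form \<open>cinner \<eta> x\<close>; so moving the base point to
  \<eta> replaces \<xi> by \<open>\<xi> - \<eta>\<close>, up to a constant factor.\<close>

lemma chi_coherent_state:
  "\<chi>_of \<theta> (coherent_state \<theta> \<xi>) \<eta> =
    (\<lambda>x. exp (1 / 2 * cinner \<xi> \<eta> + \<i> / 2 * of_real (\<theta> \<eta> \<eta>) - 1 / 4 * of_real (inner \<eta> \<eta>)) *
         exp (1 / 2 * cinner (\<xi> - \<eta>) x))"
proof
  fix x
  have "2 * omega_bd \<eta> x = \<theta> \<eta> x - \<theta> x \<eta>" using omega_theta[of \<eta> x] by simp
  then show "\<chi>_of \<theta> (coherent_state \<theta> \<xi>) \<eta> x =
      exp (1 / 2 * cinner \<xi> \<eta> + \<i> / 2 * of_real (\<theta> \<eta> \<eta>) - 1 / 4 * of_real (inner \<eta> \<eta>)) *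
      exp (1 / 2 * cinner (\<xi> - \<eta>) x)"
    unfolding \<chi>_of_def coherent_state_def \<alpha>_bd_def exp_add[symmetric] exp_diff[symmetric]
    by (intro arg_cong[of _ _ exp])
       (simp add: theta_simps g_bd_eq_inner cinner_diff_left cinner_add_right inner_add_left
         inner_add_right inner_commute cinner_eq_inner_omega[of \<eta>] complex_eq_iff field_simps)
qed

section \<open>The solution spaces as linear conditions\<close>

abbreviation "L \<equiv> EL_solutions K0 S"
abbreviation "A \<equiv> EL_solutions K0 (affine_action S C)"

text \<open>The polar form of \<open>S\<close>: it gives the derivative of \<open>S\<close> at
  \<open>x\<close> in direction \<open>y\<close>, and it is symmetric and determined by
  \<open>S\<close>, unlike the form witnessing \<open>quadratic_form S\<close>.\<close>

definition dS :: "'k \<Rightarrow> 'k \<Rightarrow> real" where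
  "dS x y = S (x + y) - S x - S y"

lemma dS_bilinear: "bilinear dS"
  and S_scale: "S (t *\<^sub>R x) = t\<^sup>2 * S x"
  and dS_self: "dS x x = 2 * S x"
proof -
  obtain B where B: "bilinear B" "\<And>x. S x = B x x"
    using S_quadratic by (auto simp: quadratic_form_def)
  have dS: "dS x y = B x y + B y x" for x y
    by (simp add: dS_def B(2) bilinear_ladd[OF B(1)] bilinear_radd[OF B(1)])
  show "bilinear dS"
    unfolding bilinear_def linear_iff dS
    by (simp add: bilinear_ladd[OF B(1)] bilinear_radd[OF B(1)] bilinear_lmul[OF B(1)]
        bilinear_rmul[OF B(1)] algebra_simps)
  show "S (t *\<^sub>R x) = t\<^sup>2 * S x"
    by (simp add: B(2) bilinear_lmul[OF B(1)] bilinear_rmul[OF B(1)] power2_eq_square)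
  show "dS x x = 2 * S x" by (simp add: dS B(2))
qed

lemma S_add: "S (x + y) = S x + S y + dS x y"
  by (simp add: dS_def)

lemma quadratic_derivative:
  assumes "linear D"
  shows "((\<lambda>t. S (\<xi> + t *\<^sub>R \<kappa>) + D (\<xi> + t *\<^sub>R \<kappa>)) has_real_derivative dS \<xi> \<kappa> + D \<kappa>) (at 0)"
proof -
  have "(\<lambda>t. S (\<xi> + t *\<^sub>R \<kappa>) + D (\<xi> + t *\<^sub>R \<kappa>)) =
      (\<lambda>t. S \<xi> + t\<^sup>2 * S \<kappa> + t * dS \<xi> \<kappa> + D \<xi> + t * D \<kappa>)"
    by (simp add: S_add S_scale bilinear_rmul[OF dS_bilinear] linear_add[OF assms] linear_scale[OF assms]
        fun_eq_iff)
  then show ?thesis by (auto intro!: derivative_eq_intros)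
qed

text \<open>Stated for an arbitrary linear source so that \<open>D = C\<close> describes
  \<open>A\<close> and \<open>D = 0\<close> describes \<open>L\<close>.\<close>

lemma EL_solutions_affine_iff:
  assumes "linear D"
  shows "\<eta> \<in> EL_solutions K0 (affine_action S D) \<longleftrightarrow> (\<forall>\<kappa>\<in>K0. dS \<eta> \<kappa> + D \<kappa> = 0)"
proof -
  have "((\<lambda>t. affine_action S D (\<eta> + t *\<^sub>R \<kappa>)) has_real_derivative 0) (at 0) \<longleftrightarrow> dS \<eta> \<kappa> + D \<kappa> = 0" for \<kappa>
    using quadratic_derivative[OF assms, of \<eta> \<kappa>] DERIV_unique
    unfolding affine_action_def by metis
  then show ?thesis by (simp add: EL_solutions_def)
qed

lemma A_iff: "\<eta> \<in> A \<longleftrightarrow> (\<forall>\<kappa>\<in>K0. dS \<eta> \<kappa> + C \<kappa> = 0)"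
  by (rule EL_solutions_affine_iff[OF C_linear])

lemma L_iff: "\<xi> \<in> L \<longleftrightarrow> (\<forall>\<kappa>\<in>K0. dS \<xi> \<kappa> = 0)"
  using EL_solutions_affine_iff[of "\<lambda>_. 0" \<xi>] linear_zero
  by (simp add: affine_action_def[abs_def])

lemma A_diff_A: "\<eta> \<in> A \<Longrightarrow> \<eta>' \<in> A \<Longrightarrow> \<eta> - \<eta>' \<in> L"
  unfolding A_iff L_iff
  by (simp add: bilinear_lsub[OF dS_bilinear]) (metis add_right_cancel)

lemma A_diff_L: "\<eta> \<in> A \<Longrightarrow> \<xi> \<in> L \<Longrightarrow> \<eta> - \<xi> \<in> A"
  unfolding A_iff L_iff by (auto simp: bilinear_lsub[OF dS_bilinear])

text \<open>Two elements of \<open>A\<close> differ by an element of \<open>L\<close>, which only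
  changes the real part; uniqueness of the decomposition and injectivity of \<open>r\<close> on
  \<open>L\<close> do the rest.\<close>

lemma A_imaginary_part_unique:
  assumes "\<eta> \<in> A" "\<eta>' \<in> A" "a \<in> L" "b \<in> L" "a' \<in> L" "b' \<in> L"
    and "r \<eta> = r a + J_bd (r b)" "r \<eta>' = r a' + J_bd (r b')"
  shows "b' = b"
proof -
  have V: "subspace (r ` L)" using L_lagrangian by (rule lagrangian_imp_subspace)
  have "r \<eta>' = r \<eta> + r (\<eta>' - \<eta>)" by (simp add: linear_diff[OF r_linear])
  then have "r a' + J_bd (r b') = (r a + r (\<eta>' - \<eta>)) + J_bd (r b)"
    using assms by (simp add: algebra_simps)
  moreover have "r a + r (\<eta>' - \<eta>) \<in> r ` L"
    using V imageI[OF assms(3)] imageI[OF A_diff_A[OF assms(2,1)]] by (rule subspace_add)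
  ultimately have "r b' = r b"
    using assms(3-6) by (intro lagrangian_decomposition_unique[OF L_lagrangian imageI imageI _ imageI])
  then show ?thesis using assms(6,4) by (rule inj_onD[OF r_inj_lin])
qed

section \<open>Evaluation of the amplitudes on coherent states\<close>

lemma linear_amplitude_coherent:
  assumes "hat_gaussian (r ` L) \<nu>" "a \<in> L" "b \<in> L"
  shows "linear_amplitude K0 S r \<theta> \<nu> (coherent_state \<theta> (r a + J_bd (r b))) =
    exp (1 / 4 * of_real (inner (r a) (r a)) - 1 / 4 * of_real (inner (r b) (r b)) -
      \<i> / 2 * of_real (inner (r a) (r b)))"
  using integral_hat_ext_exp_cinner[OF L_lagrangian assms(1), of "r a" "r b" 1] assms(2,3)
  by (simp add: linear_amplitude_def chi_coherent_state theta_simps)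

text \<open>Since \<open>\<eta>0\<close> lies in \<open>K0\<close>, it is an admissible test
  direction for the solution \<xi>, so the mixed term in the expansion of the action at
  \<open>\<eta>0 + \<xi>\<close> vanishes and the boundary formula identifies
  \<open>C \<xi>\<close>.\<close>

lemma source_eq_inner:
  assumes \<eta>0: "\<eta>0 \<in> A" "vanishes_on_boundary K0 r \<theta> \<eta>0"
    and \<eta>: "\<eta> \<in> A" "a \<in> L" "b \<in> L" "r \<eta> = r a + J_bd (r b)" and \<xi>: "\<xi> \<in> L"
  shows "C \<xi> = inner (r b) (r \<xi>)" "C \<xi> = - \<theta> (r \<eta>0) (r \<xi>)"
proof -
  have "dS \<xi> \<eta>0 = 0" using \<xi> \<eta>0(2) by (auto simp: L_iff vanishes_on_boundary_def)
  moreover have "dS \<eta>0 \<xi> = dS \<xi> \<eta>0" by (simp add: dS_def add.commute)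
  ultimately show C: "C \<xi> = - \<theta> (r \<eta>0) (r \<xi>)"
    using action_aff[OF \<eta>0(1) \<xi>] action_lin[OF \<xi>]
    by (simp add: affine_action_def S_add linear_add[OF C_linear])
  have "2 * omega_bd (r \<eta>0) (r \<xi>) = \<theta> (r \<eta>0) (r \<xi>)"
    using omega_theta[of "r \<eta>0" "r \<xi>"] \<eta>0(2) by (simp add: vanishes_on_boundary_def)
  moreover have "omega_bd (r (\<eta>0 - \<eta>)) (r \<xi>) = 0"
    using A_diff_A[OF \<eta>0(1) \<eta>(1)] \<xi> by (auto intro: lagrangian_omega_eq_0[OF L_lagrangian])
  moreover have "r \<eta>0 = r a + J_bd (r b) + r (\<eta>0 - \<eta>)"
    using \<eta>(4) by (simp add: linear_diff[OF r_linear])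
  moreover have "omega_bd (r a) (r \<xi>) = 0"
    using \<eta>(2) \<xi> by (auto intro: lagrangian_omega_eq_0[OF L_lagrangian])
  ultimately show "C \<xi> = inner (r b) (r \<xi>)"
    using C by (simp add: omega_add_left omega_J_left)
qed

text \<open>This removes \<theta> from the final exponent: the phase of
  \<open>chi_coherent_state\<close> at base point \<open>r \<eta>\<close> cancels the \<theta> part
  of the action.\<close>

lemma affine_action_eq_half_source:
  assumes \<eta>0: "\<eta>0 \<in> A" "vanishes_on_boundary K0 r \<theta> \<eta>0"
    and \<eta>: "\<eta> \<in> A" "a \<in> L" "b \<in> L" "r \<eta> = r a + J_bd (r b)"
  shows "affine_action S C \<eta> + \<theta> (r \<eta>) (r \<eta>) / 2 = C \<eta> / 2"
proof -
  define \<zeta> where "\<zeta> = \<eta> - \<eta>0"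
  have \<zeta>: "\<zeta> \<in> L" unfolding \<zeta>_def by (rule A_diff_A[OF \<eta>(1) \<eta>0(1)])
  have eq: "\<eta> = \<eta>0 + \<zeta>" by (simp add: \<zeta>_def)
  have K0: "\<eta>0 \<in> K0" and \<theta>0: "\<And>\<phi>. \<theta> \<phi> (r \<eta>0) = 0"
    using \<eta>0(2) by (simp_all add: vanishes_on_boundary_def)
  \<comment> \<open>The Euler-Lagrange equation at \<open>\<eta>0\<close> tested along
    \<open>\<eta>0\<close> itself, where the derivative of the quadratic part is
    \<open>2 * S \<eta>0\<close>.\<close>
  have "S \<eta>0 = - C \<eta>0 / 2" using \<eta>0(1) K0 dS_self[of \<eta>0] by (auto simp: A_iff)
  moreover have "C \<zeta> = - \<theta> (r \<eta>0) (r \<zeta>)" by (rule source_eq_inner(2)[OF \<eta>0 \<eta> \<zeta>])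
  moreover have "affine_action S C \<eta> = affine_action S C \<eta>0 - 1/2 * \<theta> (r \<zeta>) (r \<zeta>) - \<theta> (r \<eta>0) (r \<zeta>)"
    unfolding eq by (rule action_aff[OF \<eta>0(1) \<zeta>])
  moreover have "\<theta> (r \<eta>) (r \<eta>) = \<theta> (r \<eta>0) (r \<zeta>) + \<theta> (r \<zeta>) (r \<zeta>)"
    unfolding eq by (simp add: linear_add[OF r_linear] theta_simps \<theta>0)
  ultimately show ?thesis
    using linear_add[OF C_linear, of \<eta>0 \<zeta>]
    unfolding eq[symmetric] affine_action_def[of _ _ \<eta>0] by linarith
qed

text \<open>The Gaussian integral is taken with parameter \<open>(a - c) + J (b - d)\<close>; with
  \<open>C\<close> written as the inner product with \<open>r d\<close> on \<open>L\<close>, all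
  exponents become inner products and can be collected. The base point survives only in
  \<open>C (\<eta> - c)\<close> and \<open>C d\<close>.\<close>

lemma affine_amplitude_integrand:
  assumes \<nu>: "hat_gaussian (r ` L) \<nu>" and ab: "a \<in> L" "b \<in> L"
    and \<eta>0: "\<eta>0 \<in> A" "vanishes_on_boundary K0 r \<theta> \<eta>0"
    and \<eta>: "\<eta> \<in> A" "c \<in> L" "d \<in> L" "r \<eta> = r c + J_bd (r d)"
  shows "exp (\<i> * of_real (affine_action S C \<eta>)) *
      (\<integral>\<Phi>. hat_ext (r ` L) (\<chi>_of \<theta> (coherent_state \<theta> (r a + J_bd (r b))) (r \<eta>)) \<Phi> \<partial>\<nu>) =
    linear_amplitude K0 S r \<theta> \<nu> (coherent_state \<theta> (r a + J_bd (r b))) *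
      exp (\<i> * complex_ext C a (- b)) * exp (\<i> / 2 * of_real (C (\<eta> - c)) - 1 / 2 * of_real (C d))"
proof -
  have V: "subspace (r ` L)" using L_lagrangian by (rule lagrangian_imp_subspace)
  have diff: "r a + J_bd (r b) - r \<eta> = (r a - r c) + J_bd (r b - r d)"
    by (simp add: \<eta>(4) J_bd_diff)
  have Cin: "C x = inner (r d) (r x)" if "x \<in> L" for x
    by (rule source_eq_inner(1)[OF \<eta>0 \<eta> that])
  have CI: "C (- b) = - inner (r d) (r b)" using Cin[OF ab(2)] linear_neg[OF C_linear] by simp
  have Cdiff: "C (\<eta> - c) = C \<eta> - inner (r d) (r c)"
    using Cin[OF \<eta>(2)] linear_diff[OF C_linear] by simp
  have act: "affine_action S C \<eta> = C \<eta> / 2 - \<theta> (r \<eta>) (r \<eta>) / 2"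
    using affine_action_eq_half_source[OF \<eta>0 \<eta>] by simp
  note real = cinner_lagrangian_real[OF L_lagrangian imageI imageI]
  have cin: "cinner (r a + J_bd (r b)) (r \<eta>) =
      Complex (inner (r a) (r c) + inner (r b) (r d)) (inner (r a) (r d) - inner (r b) (r c))"
    using ab \<eta>(2,3)
    by (simp add: \<eta>(4) cinner_add_left cinner_add_right J_bd_def cinner_scaleC_left
        cinner_scaleC_right real complex_eq_iff)
  have nrm: "inner (r \<eta>) (r \<eta>) = inner (r c) (r c) + inner (r d) (r d)"
    using ab \<eta>(2,3)
    by (simp add: \<eta>(4) inner_eq_Re_cinner[of "_ + _"] cinner_add_left cinner_add_right J_bd_def
        cinner_scaleC_left cinner_scaleC_right real)
  have "r a - r c \<in> r ` L" "r b - r d \<in> r ` L"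
    using ab \<eta>(2,3) V by (auto intro: subspace_diff)
  note int = integral_hat_ext_exp_cinner[OF L_lagrangian \<nu> this]
  show ?thesis
    unfolding chi_coherent_state diff int linear_amplitude_coherent[OF \<nu> ab]
    unfolding exp_add[symmetric]
    by (intro arg_cong[of _ _ exp])
       (simp add: nrm cin act Cin[OF ab(1)] Cin[OF \<eta>(3)] CI Cdiff complex_ext_def
         inner_diff_left inner_diff_right inner_commute complex_eq_iff algebra_simps
         add_divide_distrib diff_divide_distrib)
qed

text \<open>Justifies the definite description in \<open>affine_amplitude\<close>: every base point
  yields the value \<open>?R\<close>, and \<open>A\<close> is nonempty.\<close>

lemma affine_amplitude_coherent:
  assumes \<nu>: "hat_gaussian (r ` L) \<nu>" and ab: "a \<in> L" "b \<in> L"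
    and \<eta>0: "\<eta>0 \<in> A" "vanishes_on_boundary K0 r \<theta> \<eta>0"
    and \<eta>: "\<eta> \<in> A" "c \<in> L" "d \<in> L" "r \<eta> = r c + J_bd (r d)"
  shows "affine_amplitude K0 S C r \<theta> \<nu> (coherent_state \<theta> (r a + J_bd (r b))) =
    linear_amplitude K0 S r \<theta> \<nu> (coherent_state \<theta> (r a + J_bd (r b))) *
      exp (\<i> * complex_ext C a (- b)) * exp (\<i> / 2 * of_real (C (\<eta> - c)) - 1 / 2 * of_real (C d))"
    (is "_ = ?R")
proof -
  have indep: "C (\<eta>' - c') = C (\<eta> - c)"
    if "\<eta>' \<in> A" "c' \<in> L" "r \<eta>' = r c' + J_bd (r d)" for \<eta>' c'
  proof -
    \<comment> \<open>Both sides equal \<open>J_bd (r d)\<close>, and both arguments lie in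
      \<open>A\<close>, where \<open>r\<close> is injective.\<close>
    have "r (\<eta>' - c') = r (\<eta> - c)" using that \<eta> by (simp add: linear_diff[OF r_linear])
    then have "\<eta>' - c' = \<eta> - c"
      using that(1,2) \<eta>(1,2) by (intro inj_onD[OF r_inj_aff] A_diff_L)
    then show ?thesis by simp
  qed
  have "exp (\<i> * of_real (affine_action S C \<eta>')) *
      (\<integral>\<Phi>. hat_ext (r ` L) (\<chi>_of \<theta> (coherent_state \<theta> (r a + J_bd (r b))) (r \<eta>')) \<Phi> \<partial>\<nu>) = ?R"
    if \<eta>': "\<eta>' \<in> A" for \<eta>'
  proof -
    obtain c' d' where c': "c' \<in> L" "d' \<in> L" "r \<eta>' = r c' + J_bd (r d')"
      using lagrangian_decomposition[OF L_lagrangian L_closed, of "r \<eta>'"] by blast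
    have "d' = d" using A_imaginary_part_unique[OF \<eta>(1) \<eta>' \<eta>(2,3) c'(1,2) \<eta>(4) c'(3)] .
    with affine_amplitude_integrand[OF \<nu> ab \<eta>0 \<eta>' c'] indep[of \<eta>' c'] c' \<eta>'
    show ?thesis by simp
  qed
  then show ?thesis unfolding affine_amplitude_def
    by (intro the_equality) (use \<eta>(1) in auto)
qed

end

theorem mainTheorem3:
  fixes K0 Kn :: "'k::real_vector set"
    and S C :: "'k \<Rightarrow> real"
    and r :: "'k \<Rightarrow> 'l::complex_hilbert_space"
    and \<theta> :: "'l \<Rightarrow> 'l \<Rightarrow> real"
    and \<nu> :: "(('l \<Rightarrow> real) \<Rightarrow> real) measure"
  defines "L \<equiv> EL_solutions K0 S"
    and "A \<equiv> EL_solutions K0 (affine_action S C)"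
    and "\<rho> \<equiv> linear_amplitude K0 S r \<theta> \<nu>"
    and "\<rho>\<mu> \<equiv> affine_amplitude K0 S C r \<theta> \<nu>"
    and "K \<equiv> coherent_state \<theta>"
  assumes "affine_field_theory K0 Kn S C r \<theta>"
    and "hat_gaussian (r ` L) \<nu>"
    and "\<exists>\<eta>\<^sub>0\<in>A. vanishes_on_boundary K0 r \<theta> \<eta>\<^sub>0"
  shows "(\<forall>\<xi>. \<forall>\<xi>R\<in>L. \<forall>\<xi>I\<in>L. \<xi> = r \<xi>R + J_bd (r \<xi>I) \<longrightarrow>
            \<rho>\<mu> (K \<xi>) = \<rho> (K \<xi>) * exp (\<i> * complex_ext C \<xi>R (- \<xi>I)) * \<rho>\<mu> (K 0))
       \<and> (\<forall>\<eta>\<in>A. \<forall>\<eta>R\<in>L. \<forall>\<eta>I\<in>L. r \<eta> = r \<eta>R + J_bd (r \<eta>I) \<longrightarrow>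
            (\<forall>\<eta>'\<in>A. \<forall>\<eta>R'\<in>L. \<forall>\<eta>I'\<in>L. r \<eta>' = r \<eta>R' + J_bd (r \<eta>I') \<longrightarrow> \<eta>I' = \<eta>I) \<and>
            \<eta> - \<eta>R \<in> A \<and>
            \<rho>\<mu> (K 0) = exp (\<i> / 2 * of_real (C (\<eta> - \<eta>R)) - 1 / 2 * of_real (C \<eta>I)))"
proof -
  interpret affine_field_theory K0 Kn S C r \<theta> by fact
  obtain \<eta>0 where \<eta>0: "\<eta>0 \<in> A" "vanishes_on_boundary K0 r \<theta> \<eta>0" using assms by blast
  note \<nu> = \<open>hat_gaussian (r ` L) \<nu>\<close>
  have L0: "0 \<in> L"
    by (simp add: L_def L_iff bilinear_lzero[OF dS_bilinear])
  have r0: "r 0 + J_bd (r 0) = 0"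
    by (simp add: linear_0[OF r_linear])
  have \<rho>\<mu>: "\<rho>\<mu> (K (r a + J_bd (r b))) = \<rho> (K (r a + J_bd (r b))) * exp (\<i> * complex_ext C a (- b)) *
      exp (\<i> / 2 * of_real (C (\<eta> - c)) - 1 / 2 * of_real (C d))"
    if "a \<in> L" "b \<in> L" "\<eta> \<in> A" "c \<in> L" "d \<in> L" "r \<eta> = r c + J_bd (r d)" for a b c d \<eta>
    using affine_amplitude_coherent[OF \<nu>[unfolded L_def] _ _ \<eta>0[unfolded A_def]] that
    by (simp add: L_def A_def \<rho>\<mu>_def \<rho>_def K_def)
  \<comment> \<open>With \<xi> = 0 the first two factors of the amplitude formula are 1, so its last
    factor is the amplitude of \<open>K 0\<close>.\<close>
  have "\<rho> (K 0) = 1"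
    using linear_amplitude_coherent[OF \<nu>[unfolded L_def], of 0 0] L0
    by (simp add: \<rho>_def K_def L_def r0 linear_0[OF r_linear])
  then have \<rho>\<mu>0: "\<rho>\<mu> (K 0) = exp (\<i> / 2 * of_real (C (\<eta> - c)) - 1 / 2 * of_real (C d))"
    if "\<eta> \<in> A" "c \<in> L" "d \<in> L" "r \<eta> = r c + J_bd (r d)" for c d \<eta>
    using \<rho>\<mu>[OF L0 L0 that] by (simp add: r0 complex_ext_def linear_0[OF C_linear])
  \<comment> \<open>Decomposing \<open>\<eta>0\<close> provides one explicit form of the amplitude
    of \<open>K 0\<close>, to be recognised as the last factor for general \<xi>.\<close>
  obtain c d where "c \<in> L" "d \<in> L" "r \<eta>0 = r c + J_bd (r d)"
    using lagrangian_decomposition[OF L_lagrangian L_closed, of "r \<eta>0"] unfolding L_def by blast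
  note cd = \<eta>0(1) this
  have coherent: "\<rho>\<mu> (K \<xi>) = \<rho> (K \<xi>) * exp (\<i> * complex_ext C \<xi>R (- \<xi>I)) * \<rho>\<mu> (K 0)"
    if "\<xi>R \<in> L" "\<xi>I \<in> L" "\<xi> = r \<xi>R + J_bd (r \<xi>I)" for \<xi> \<xi>R \<xi>I
    unfolding that(3) \<rho>\<mu>0[OF cd] by (rule \<rho>\<mu>[OF that(1,2) cd])
  have unique: "\<eta>I' = \<eta>I"
    if "\<eta> \<in> A" "\<eta>R \<in> L" "\<eta>I \<in> L" "r \<eta> = r \<eta>R + J_bd (r \<eta>I)"
      "\<eta>' \<in> A" "\<eta>R' \<in> L" "\<eta>I' \<in> L" "r \<eta>' = r \<eta>R' + J_bd (r \<eta>I')" for \<eta> \<eta>R \<eta>I \<eta>' \<eta>R' \<eta>I'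
    by (rule A_imaginary_part_unique[OF that(1,5,2,3,6,7,4,8)[unfolded L_def A_def]])
  have diff: "\<eta> - \<eta>R \<in> A" if "\<eta> \<in> A" "\<eta>R \<in> L" for \<eta> \<eta>R
    using that unfolding L_def A_def by (rule A_diff_L)
  show ?thesis
    by (intro conjI allI ballI impI)
       (fact coherent unique | rule diff, assumption+ | rule \<rho>\<mu>0, assumption+)+
qed

end
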